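(* Let $\mathbf{k}$ be a field and let $A$ be a commutative $\mathbf{k}$-algebra with identity generated by invertible elements $a_1,\ldots,a_s\in A^\times$, with a Frobenius duality given by a linear function $\ell\colon A\to\mathbf{k}$. Then $A\simeq K_f$ as algebras, where \[ f\colon \mathbb{Z}^s\to\mathbf{k},\qquad f(n_1,\dots,n_s)=\ell(a_1^{n_1}\cdots a_s^{n_s}). \]
   Context: A linear function $\ell\colon A\to \mathbf{k}$ on a commutative $\mathbf{k}$-algebra $A$ gives a Frobenius duality if the symmetric bilinear pairing $\langle a,b\rangle_\ell=\ell(ab)$ is non-degenerate (for every $0\neq a\in A$ there is $b\in A$ with $\ell(ab)\neq 0$). For a free abelian group $\Lambda$, $\mathrm{Sh}(\Lambda)=\mathbf{k}[\Lambda]$ is the group algebra, acting on functions $f\colon\Lambda\to\mathbf{k}$ by $(t\cdot f)(x)=\sum_i a_i f(x+\lambda_i)$ for $t=\sum_i a_i\lambda_i$. For $f\colon\Lambda\to\mathbf{k}$ put $\mathrm{Ann}(f)=\{s\in\mathrm{Sh}(\Lambda)\mid s\cdot f\equiv 0\}$ (an ideal) and $K_f=\mathrm{Sh}(\Lambda)/\mathrm{Ann}(f)$. *)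

theory Defs
  imports "HOL-Algebra.Algebra"
begin

text \<open>
  Algebras over a field are modelled by the locale \<^locale>\<open>algebra\<close> of HOL-Algebra; abelian
  groups (written multiplicatively) by \<^locale>\<open>comm_group\<close>.
\<close>

definition linear_form ::
  "('k, 'm) ring_scheme \<Rightarrow> ('k, 'a, 'n) module_scheme \<Rightarrow> ('a \<Rightarrow> 'k) \<Rightarrow> bool" where
  "linear_form K A ell \<longleftrightarrow>
     ell \<in> carrier A \<rightarrow> carrier K \<and>
     (\<forall>x\<in>carrier A. \<forall>y\<in>carrier A. ell (x \<oplus>\<^bsub>A\<^esub> y) = ell x \<oplus>\<^bsub>K\<^esub> ell y) \<and>
     (\<forall>c\<in>carrier K. \<forall>x\<in>carrier A. ell (c \<odot>\<^bsub>A\<^esub> x) = c \<otimes>\<^bsub>K\<^esub> ell x)"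

definition frobenius_duality ::
  "('k, 'm) ring_scheme \<Rightarrow> ('k, 'a, 'n) module_scheme \<Rightarrow> ('a \<Rightarrow> 'k) \<Rightarrow> bool" where
  "frobenius_duality K A ell \<longleftrightarrow>
     linear_form K A ell \<and>
     (\<forall>x\<in>carrier A. x \<noteq> \<zero>\<^bsub>A\<^esub> \<longrightarrow> (\<exists>y\<in>carrier A. ell (x \<otimes>\<^bsub>A\<^esub> y) \<noteq> \<zero>\<^bsub>K\<^esub>))"

text \<open>The unital subalgebra generated by a set; no inverses are adjoined.\<close>

definition generated_algebra ::
  "('k, 'm) ring_scheme \<Rightarrow> ('k, 'a, 'n) module_scheme \<Rightarrow> 'a set \<Rightarrow> 'a set" where
  "generated_algebra K A S = \<Inter> {B. subring B A \<and> submodule B K A \<and> S \<subseteq> B}"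

definition algebra_isomorphic ::
  "('k, 'm) ring_scheme \<Rightarrow> ('k, 'a, 'n) module_scheme \<Rightarrow> ('k, 'b, 'p) module_scheme \<Rightarrow> bool" where
  "algebra_isomorphic K A B \<longleftrightarrow>
     (\<exists>h \<in> ring_iso A B. \<forall>c\<in>carrier K. \<forall>x\<in>carrier A. h (c \<odot>\<^bsub>A\<^esub> x) = c \<odot>\<^bsub>B\<^esub> h x)"

definition fun_support ::
  "('k, 'm) ring_scheme \<Rightarrow> ('g, 'l) monoid_scheme \<Rightarrow> ('g \<Rightarrow> 'k) \<Rightarrow> 'g set" where
  "fun_support K L t = {x \<in> carrier L. t x \<noteq> \<zero>\<^bsub>K\<^esub>}"

text \<open>
  The group algebra \<open>Sh(L)\<close>: a formal combination of elements of \<open>L\<close> is the finitely supported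
  function of its coefficients, extensional outside \<open>carrier L\<close>; multiplication is convolution.
\<close>

definition Sh :: "('k, 'm) ring_scheme \<Rightarrow> ('g, 'l) monoid_scheme \<Rightarrow> ('k, 'g \<Rightarrow> 'k) module" where
  "Sh K L =
     \<lparr>carrier = {t \<in> carrier L \<rightarrow>\<^sub>E carrier K. finite (fun_support K L t)},
      monoid.mult = (\<lambda>t u. \<lambda>x\<in>carrier L.
        \<Oplus>\<^bsub>K\<^esub>y\<in>fun_support K L t. t y \<otimes>\<^bsub>K\<^esub> u (inv\<^bsub>L\<^esub> y \<otimes>\<^bsub>L\<^esub> x)),
      monoid.one = (\<lambda>x\<in>carrier L. if x = \<one>\<^bsub>L\<^esub> then \<one>\<^bsub>K\<^esub> else \<zero>\<^bsub>K\<^esub>),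
      ring.zero = (\<lambda>x\<in>carrier L. \<zero>\<^bsub>K\<^esub>),
      ring.add = (\<lambda>t u. \<lambda>x\<in>carrier L. t x \<oplus>\<^bsub>K\<^esub> u x),
      module.smult = (\<lambda>c t. \<lambda>x\<in>carrier L. c \<otimes>\<^bsub>K\<^esub> t x)\<rparr>"

definition Sh_action ::
  "('k, 'm) ring_scheme \<Rightarrow> ('g, 'l) monoid_scheme \<Rightarrow> ('g \<Rightarrow> 'k) \<Rightarrow> ('g \<Rightarrow> 'k) \<Rightarrow> 'g \<Rightarrow> 'k" where
  "Sh_action K L t f x = (\<Oplus>\<^bsub>K\<^esub>y\<in>fun_support K L t. t y \<otimes>\<^bsub>K\<^esub> f (x \<otimes>\<^bsub>L\<^esub> y))"

definition Ann ::
  "('k, 'm) ring_scheme \<Rightarrow> ('g, 'l) monoid_scheme \<Rightarrow> ('g \<Rightarrow> 'k) \<Rightarrow> ('g \<Rightarrow> 'k) set" where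
  "Ann K L f = {t \<in> carrier (Sh K L). \<forall>x\<in>carrier L. Sh_action K L t f x = \<zero>\<^bsub>K\<^esub>}"

text \<open>
  \<^const>\<open>FactRing\<close> has no scalar multiplication; the one added here is written in the style of
  \<^const>\<open>rcoset_mult\<close> and sends the class of \<open>t\<close> to the class of \<open>c\<close> times \<open>t\<close>.
\<close>

definition quotient_algebra ::
  "('k, 'a, 'n) module_scheme \<Rightarrow> 'a set \<Rightarrow> ('k, 'a set) module" where
  "quotient_algebra A I =
     ring.extend (A Quot I) (module.fields (\<lambda>c C. \<Union>x\<in>C. I +>\<^bsub>A\<^esub> (c \<odot>\<^bsub>A\<^esub> x)))"

definition K_alg ::
  "('k, 'm) ring_scheme \<Rightarrow> ('g, 'l) monoid_scheme \<Rightarrow> ('g \<Rightarrow> 'k) \<Rightarrow> ('k, ('g \<Rightarrow> 'k) set) module" where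
  "K_alg K L f = quotient_algebra (Sh K L) (Ann K L f)"

text \<open>The lattice of integer vectors \<open>(n 1, \<dots>, n s)\<close>, with componentwise addition.\<close>

definition int_lattice :: "nat \<Rightarrow> (nat \<Rightarrow> int) monoid" where
  "int_lattice s = product_group {1..s} (\<lambda>_. integer_group)"

end

theory Submission
  imports Defs
begin

text \<open>
  The monomials \<open>m n = a 1 [^] n 1 \<otimes> \<dots> \<otimes> a s [^] n s\<close> turn addition of exponent vectors into
  multiplication in \<open>A\<close>, so \<open>m\<close> extends linearly to a homomorphism \<open>ext\<close> of algebras from \<open>Sh\<close> of
  the lattice to \<open>A\<close> (\<open>ext_mult\<close>). Its image is a subalgebra that contains the generators
  \<open>a i\<close>, which are themselves monomials, so \<open>ext\<close> is surjective (\<open>image_ext_eq_carrier\<close>).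

  For \<open>f n = ell (m n)\<close>, unfolding the action gives \<open>(t \<cdot> f) x = ell (ext t \<otimes> m x)\<close>
  (\<open>Sh_action_eq\<close>). Hence \<open>t\<close> annihilates \<open>f\<close> exactly when \<open>ext t\<close> is orthogonal to every
  monomial. By surjectivity the monomials span \<open>A\<close>, so this means that \<open>ext t\<close> is orthogonal to all
  of \<open>A\<close>, and non-degeneracy turns it into \<open>ext t = \<zero>\<close>. The annihilator is therefore the
  kernel of \<open>ext\<close> (\<open>Ann_eq_kernel\<close>), and the first isomorphism theorem
  (\<open>quotient_algebra_kernel_iso\<close>) concludes.
\<close>

section \<open>Sums in abelian monoids and modules\<close>

lemma (in abelian_monoid) finsum_swap:
  assumes "finite B" and "finite C"
    and f: "\<And>x y. x \<in> B \<Longrightarrow> y \<in> C \<Longrightarrow> f x y \<in> carrier G"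
  shows "(\<Oplus>x\<in>B. \<Oplus>y\<in>C. f x y) = (\<Oplus>y\<in>C. \<Oplus>x\<in>B. f x y)"
  using assms(1) f
proof (induction B)
  case empty
  then show ?case by (simp add: finsum_zero)
next
  case (insert x B)
  have 1: "(\<lambda>y. f x y) \<in> C \<rightarrow> carrier G" "(\<lambda>y. \<Oplus>x\<in>B. f x y) \<in> C \<rightarrow> carrier G"
    using insert.prems by (auto intro!: finsum_closed)
  have "(\<Oplus>x\<in>insert x B. \<Oplus>y\<in>C. f x y) = (\<Oplus>y\<in>C. f x y) \<oplus> (\<Oplus>x\<in>B. \<Oplus>y\<in>C. f x y)"
    using insert by (intro finsum_insert) (auto intro!: finsum_closed)
  also have "\<dots> = (\<Oplus>y\<in>C. f x y) \<oplus> (\<Oplus>y\<in>C. \<Oplus>x\<in>B. f x y)"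
    using insert by simp
  also have "\<dots> = (\<Oplus>y\<in>C. f x y \<oplus> (\<Oplus>x\<in>B. f x y))"
    using 1 by (simp add: finsum_addf)
  also have "\<dots> = (\<Oplus>y\<in>C. \<Oplus>x\<in>insert x B. f x y)"
    using insert by (intro finsum_cong') (auto intro!: finsum_closed finsum_insert[symmetric])
  finally show ?case .
qed

lemma (in module) finsum_smult_rdistr:
  assumes "finite B" "f \<in> B \<rightarrow> carrier R" "x \<in> carrier M"
  shows "(\<Oplus>i\<in>B. f i) \<odot>\<^bsub>M\<^esub> x = (\<Oplus>\<^bsub>M\<^esub>i\<in>B. f i \<odot>\<^bsub>M\<^esub> x)"
  using assms(1,2)
proof (induction B)
  case empty
  then show ?case using assms(3) by simp
next
  case (insert i B)
  have "(\<Oplus>i\<in>insert i B. f i) \<odot>\<^bsub>M\<^esub> x = (f i \<oplus> (\<Oplus>i\<in>B. f i)) \<odot>\<^bsub>M\<^esub> x"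
    using insert by (subst R.finsum_insert) auto
  also have "\<dots> = f i \<odot>\<^bsub>M\<^esub> x \<oplus>\<^bsub>M\<^esub> (\<Oplus>\<^bsub>M\<^esub>i\<in>B. f i \<odot>\<^bsub>M\<^esub> x)"
    using insert assms(3) by (subst smult_l_distr) (auto intro!: R.finsum_closed)
  also have "\<dots> = (\<Oplus>\<^bsub>M\<^esub>i\<in>insert i B. f i \<odot>\<^bsub>M\<^esub> x)"
    using insert assms(3) by (intro M.finsum_insert[symmetric]) auto
  finally show ?case .
qed

lemma (in module) linear_form_finsum:
  assumes "linear_form R M ell" "finite B" "f \<in> B \<rightarrow> carrier M"
  shows "ell (\<Oplus>\<^bsub>M\<^esub>i\<in>B. f i) = (\<Oplus>i\<in>B. ell (f i))"
  using assms(2,3)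
proof (induction B)
  case empty
  have "ell \<zero>\<^bsub>M\<^esub> = ell (\<zero> \<odot>\<^bsub>M\<^esub> \<zero>\<^bsub>M\<^esub>)" by simp
  also have "\<dots> = \<zero>"
    using assms(1) by (simp add: linear_form_def Pi_iff del: smult_l_null smult_r_null)
  finally show ?case by simp
next
  case (insert i B)
  have "ell (\<Oplus>\<^bsub>M\<^esub>i\<in>insert i B. f i) = ell (f i \<oplus>\<^bsub>M\<^esub> (\<Oplus>\<^bsub>M\<^esub>i\<in>B. f i))"
    using insert by (subst M.finsum_insert) auto
  also have "\<dots> = ell (f i) \<oplus> ell (\<Oplus>\<^bsub>M\<^esub>i\<in>B. f i)"
    using insert assms(1) by (auto simp: linear_form_def intro!: M.finsum_closed)
  also have "\<dots> = (\<Oplus>i\<in>insert i B. ell (f i))"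
    using insert assms(1)
    by (subst R.finsum_insert) (auto simp: linear_form_def Pi_iff)
  finally show ?case .
qed


section \<open>Quotients by kernels\<close>

text \<open>
  The first isomorphism theorem for \<^const>\<open>quotient_algebra\<close>. The isomorphism goes from the image
  to the quotient and sends an element to its fibre under \<open>h\<close>, which is a coset of the kernel.
  Besides the closure conditions, only the additive group laws of the source are needed; in
  particular its multiplication is not assumed to be associative or distributive.
\<close>

lemma quotient_algebra_kernel_iso:
  fixes S :: "('k, 'b, 'p) module_scheme"
    and A :: "('k, 'a, 'n) module_scheme"
  assumes S: "abelian_group S"
    and A: "abelian_group A"
    and S_mult: "\<And>t u. t \<in> carrier S \<Longrightarrow> u \<in> carrier S \<Longrightarrow> t \<otimes>\<^bsub>S\<^esub> u \<in> carrier S"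
    and S_one: "\<one>\<^bsub>S\<^esub> \<in> carrier S"
    and S_smult: "\<And>c t. c \<in> carrier K \<Longrightarrow> t \<in> carrier S \<Longrightarrow> c \<odot>\<^bsub>S\<^esub> t \<in> carrier S"
    and surj: "h ` carrier S = carrier A"
    and add: "\<And>t u. t \<in> carrier S \<Longrightarrow> u \<in> carrier S \<Longrightarrow> h (t \<oplus>\<^bsub>S\<^esub> u) = h t \<oplus>\<^bsub>A\<^esub> h u"
    and mult: "\<And>t u. t \<in> carrier S \<Longrightarrow> u \<in> carrier S \<Longrightarrow> h (t \<otimes>\<^bsub>S\<^esub> u) = h t \<otimes>\<^bsub>A\<^esub> h u"
    and one: "h \<one>\<^bsub>S\<^esub> = \<one>\<^bsub>A\<^esub>"
    and smult: "\<And>c t. c \<in> carrier K \<Longrightarrow> t \<in> carrier S \<Longrightarrow> h (c \<odot>\<^bsub>S\<^esub> t) = c \<odot>\<^bsub>A\<^esub> h t"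
  shows "algebra_isomorphic K A (quotient_algebra S {t \<in> carrier S. h t = \<zero>\<^bsub>A\<^esub>})"
proof -
  interpret S: abelian_group S by fact
  interpret A: abelian_group A by fact
  define I where "I = {t \<in> carrier S. h t = \<zero>\<^bsub>A\<^esub>}"
  define F where "F x = {t \<in> carrier S. h t = x}" for x
  have h_closed: "h t \<in> carrier A" if "t \<in> carrier S" for t
    using that surj by blast
  have preimage: "\<exists>t\<in>carrier S. h t = x" if "x \<in> carrier A" for x
    using that unfolding surj[symmetric] by auto
  \<comment> \<open>Cosets of the kernel are the fibres, so the quotient operations can be computed on fibres.\<close>
  have coset: "I +>\<^bsub>S\<^esub> t = F (h t)" if t: "t \<in> carrier S" for t
  proof (intro equalityI subsetI)
    fix u assume "u \<in> I +>\<^bsub>S\<^esub> t"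
    then show "u \<in> F (h t)"
      using t h_closed by (auto simp: a_r_coset_def' I_def F_def add)
  next
    fix u assume "u \<in> F (h t)"
    then have u: "u \<in> carrier S" "h u = h t" by (auto simp: F_def)
    define d where "d = u \<ominus>\<^bsub>S\<^esub> t"
    have d: "d \<in> carrier S" "d \<oplus>\<^bsub>S\<^esub> t = u"
      using u t by (auto simp: d_def S.minus_eq S.a_assoc S.l_neg)
    then have "h d \<oplus>\<^bsub>A\<^esub> h t = h t"
      using add[of d t] u t by simp
    then have "h d = \<zero>\<^bsub>A\<^esub>"
      using h_closed d(1) t A.add.r_cancel_one by blast
    then show "u \<in> I +>\<^bsub>S\<^esub> t"
      using d by (auto simp: a_r_coset_def' I_def)
  qed
  have Q: "carrier (quotient_algebra S I) = F ` carrier A"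
    "monoid.mult (quotient_algebra S I) = rcoset_mult S I"
    "monoid.one (quotient_algebra S I) = I +>\<^bsub>S\<^esub> \<one>\<^bsub>S\<^esub>"
    "ring.add (quotient_algebra S I) = set_add S"
    "module.smult (quotient_algebra S I) = (\<lambda>c C. \<Union>x\<in>C. I +>\<^bsub>S\<^esub> (c \<odot>\<^bsub>S\<^esub> x))"
    using coset
    by (auto simp: quotient_algebra_def ring.defs module.defs FactRing_def A_RCOSETS_def'
        surj[symmetric])
  have "F \<in> ring_iso A (quotient_algebra S I)"
  proof (rule ring_iso_memI)
    fix x y assume xy: "x \<in> carrier A" "y \<in> carrier A"
    then obtain t u where tu: "t \<in> carrier S" "h t = x" "u \<in> carrier S" "h u = y"
      using preimage by metis
    have "rcoset_mult S I (F x) (F y) = (\<Union>t\<in>F x. \<Union>u\<in>F y. F (x \<otimes>\<^bsub>A\<^esub> y))"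
      unfolding rcoset_mult_def
      by (intro SUP_cong refl) (auto simp: F_def[of x] F_def[of y] S_mult coset mult)
    also have "\<dots> = F (x \<otimes>\<^bsub>A\<^esub> y)"
      using tu by (auto simp: F_def)
    finally show "F (x \<otimes>\<^bsub>A\<^esub> y) = F x \<otimes>\<^bsub>quotient_algebra S I\<^esub> F y"
      by (simp add: Q)
    have "F (x \<oplus>\<^bsub>A\<^esub> y) \<subseteq> set_add S (F x) (F y)"
    proof
      fix v assume "v \<in> F (x \<oplus>\<^bsub>A\<^esub> y)"
      then have "v \<in> I +>\<^bsub>S\<^esub> (t \<oplus>\<^bsub>S\<^esub> u)"
        using tu by (simp add: coset add)
      then obtain i where i: "i \<in> I" "v = i \<oplus>\<^bsub>S\<^esub> (t \<oplus>\<^bsub>S\<^esub> u)"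
        by (auto simp: a_r_coset_def')
      have "i \<oplus>\<^bsub>S\<^esub> t \<in> F x" "u \<in> F y" "v = (i \<oplus>\<^bsub>S\<^esub> t) \<oplus>\<^bsub>S\<^esub> u"
        using i tu h_closed[of t] by (auto simp: F_def I_def add S.a_assoc)
      then show "v \<in> set_add S (F x) (F y)"
        by (auto simp: set_add_def')
    qed
    moreover have "set_add S (F x) (F y) \<subseteq> F (x \<oplus>\<^bsub>A\<^esub> y)"
      by (auto simp: set_add_def' F_def add)
    ultimately show "F (x \<oplus>\<^bsub>A\<^esub> y) = F x \<oplus>\<^bsub>quotient_algebra S I\<^esub> F y"
      by (simp add: Q)
  next
    show "F \<one>\<^bsub>A\<^esub> = \<one>\<^bsub>quotient_algebra S I\<^esub>"
      by (simp add: Q coset S_one one)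
    have "inj_on F (carrier A)"
    proof (rule inj_onI)
      fix x y assume "x \<in> carrier A" "F x = F y"
      with preimage[of x] show "x = y" by (auto simp: F_def)
    qed
    then show "bij_betw F (carrier A) (carrier (quotient_algebra S I))"
      by (simp add: Q bij_betw_def)
  qed (simp add: Q)
  moreover have "F (c \<odot>\<^bsub>A\<^esub> x) = c \<odot>\<^bsub>quotient_algebra S I\<^esub> F x"
    if c: "c \<in> carrier K" and x: "x \<in> carrier A" for c x
  proof -
    have "(\<Union>t\<in>F x. I +>\<^bsub>S\<^esub> (c \<odot>\<^bsub>S\<^esub> t)) = (\<Union>t\<in>F x. F (c \<odot>\<^bsub>A\<^esub> x))"
      by (intro SUP_cong refl) (auto simp: F_def[of x] S_smult c coset smult)
    also have "\<dots> = F (c \<odot>\<^bsub>A\<^esub> x)"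
      using preimage[OF x] by (auto simp: F_def)
    finally show ?thesis by (simp add: Q)
  qed
  ultimately show ?thesis
    unfolding algebra_isomorphic_def I_def by blast
qed


section \<open>Extending a character to the group algebra\<close>

text \<open>
  A character is a unital multiplicative map \<open>m\<close> from a group into the multiplicative monoid of a
  commutative algebra. The group need not be commutative.
\<close>

locale group_character = algebra K A + L: group L
  for K :: "('k, 'm) ring_scheme"
    and A :: "('k, 'a, 'n) module_scheme"
    and L :: "('g, 'l) monoid_scheme" +
  fixes m :: "'g \<Rightarrow> 'a"
  assumes m_closed [simp]: "x \<in> carrier L \<Longrightarrow> m x \<in> carrier A"
    and m_mult: "x \<in> carrier L \<Longrightarrow> y \<in> carrier L \<Longrightarrow> m (x \<otimes>\<^bsub>L\<^esub> y) = m x \<otimes>\<^bsub>A\<^esub> m y"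
    and m_one: "m \<one>\<^bsub>L\<^esub> = \<one>\<^bsub>A\<^esub>"
begin

text \<open>
  The linear extension of \<open>m\<close> to formal combinations of group elements. If the support is
  infinite, the value is the default \<open>\<zero>\<close> of an infinite sum.
\<close>

definition ext :: "('g \<Rightarrow> 'k) \<Rightarrow> 'a" where
  "ext t = (\<Oplus>\<^bsub>A\<^esub>y\<in>fun_support K L t. t y \<odot>\<^bsub>A\<^esub> m y)"

abbreviation supp where "supp \<equiv> fun_support K L"

lemma supp_subset: "supp t \<subseteq> carrier L"
  by (auto simp: fun_support_def)

lemma ShD:
  assumes "t \<in> carrier (Sh K L)"
  shows "\<And>x. x \<in> carrier L \<Longrightarrow> t x \<in> carrier K" and "finite (supp t)" and "t \<in> extensional (carrier L)"
  using assms by (auto simp: Sh_def PiE_iff)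

lemma ShI:
  assumes "t \<in> extensional (carrier L)" "\<And>x. x \<in> carrier L \<Longrightarrow> t x \<in> carrier K"
    and "finite F" "\<And>x. x \<in> carrier L \<Longrightarrow> x \<notin> F \<Longrightarrow> t x = \<zero>\<^bsub>K\<^esub>"
  shows "t \<in> carrier (Sh K L)"
proof -
  have "supp t \<subseteq> F" using assms(4) by (auto simp: fun_support_def)
  then show ?thesis using assms by (auto simp: Sh_def PiE_iff intro: finite_subset)
qed

text \<open>
  The support of a sum or a product is in general only contained in the expected finite set, because
  terms may cancel; this lemma allows summing over such a larger set.
\<close>

lemma ext_eq_finsum:
  assumes "t \<in> carrier (Sh K L)" "finite F" "supp t \<subseteq> F" "F \<subseteq> carrier L"
  shows "ext t = (\<Oplus>\<^bsub>A\<^esub>y\<in>F. t y \<odot>\<^bsub>A\<^esub> m y)"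
  unfolding ext_def
proof (rule M.add.finprod_mono_neutral_cong_left)
  show "\<And>i. i \<in> F - supp t \<Longrightarrow> t i \<odot>\<^bsub>A\<^esub> m i = \<zero>\<^bsub>A\<^esub>"
    using assms(4) by (auto simp: fun_support_def)
qed (use assms ShD[OF assms(1)] in auto)

lemma ext_closed [simp]: "t \<in> carrier (Sh K L) \<Longrightarrow> ext t \<in> carrier A"
  unfolding ext_def using ShD[of t] supp_subset[of t] by (auto intro!: M.finsum_closed)

subsection \<open>The additive structure\<close>

lemma Sh_add_closed:
  assumes "t \<in> carrier (Sh K L)" "u \<in> carrier (Sh K L)"
  shows "t \<oplus>\<^bsub>Sh K L\<^esub> u \<in> carrier (Sh K L)"
  by (rule ShI[where F = "supp t \<union> supp u"])
    (use assms ShD in \<open>auto simp: fun_support_def Sh_def\<close>)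

lemma Sh_smult_closed:
  assumes "c \<in> carrier K" "t \<in> carrier (Sh K L)"
  shows "c \<odot>\<^bsub>Sh K L\<^esub> t \<in> carrier (Sh K L)"
  by (rule ShI[where F = "supp t"])
    (use assms ShD in \<open>auto simp: fun_support_def Sh_def\<close>)

lemma Sh_abelian_group: "abelian_group (Sh K L)"
proof (rule abelian_groupI)
  show "\<zero>\<^bsub>Sh K L\<^esub> \<in> carrier (Sh K L)"
    by (rule ShI[where F = "{}"]) (auto simp: Sh_def)
  fix t assume t: "t \<in> carrier (Sh K L)"
  show "\<zero>\<^bsub>Sh K L\<^esub> \<oplus>\<^bsub>Sh K L\<^esub> t = t"
    using ShD[OF t] by (auto simp: Sh_def fun_eq_iff extensional_def)
  define u where "u = (\<lambda>x\<in>carrier L. \<ominus>\<^bsub>K\<^esub> t x)"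
  have "u \<in> carrier (Sh K L)"
    by (rule ShI[where F = "supp t"]) (use ShD[OF t] in \<open>auto simp: fun_support_def u_def\<close>)
  moreover have "u \<oplus>\<^bsub>Sh K L\<^esub> t = \<zero>\<^bsub>Sh K L\<^esub>"
    using ShD[OF t] by (auto simp: Sh_def u_def R.l_neg)
  ultimately show "\<exists>u\<in>carrier (Sh K L). u \<oplus>\<^bsub>Sh K L\<^esub> t = \<zero>\<^bsub>Sh K L\<^esub>" by blast
next
  fix t u assume tu: "t \<in> carrier (Sh K L)" "u \<in> carrier (Sh K L)"
  show "t \<oplus>\<^bsub>Sh K L\<^esub> u = u \<oplus>\<^bsub>Sh K L\<^esub> t"
    using tu[THEN ShD(1)] by (auto simp: Sh_def R.a_comm)
  fix v assume v: "v \<in> carrier (Sh K L)"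
  show "t \<oplus>\<^bsub>Sh K L\<^esub> u \<oplus>\<^bsub>Sh K L\<^esub> v = t \<oplus>\<^bsub>Sh K L\<^esub> (u \<oplus>\<^bsub>Sh K L\<^esub> v)"
    using tu[THEN ShD(1)] v[THEN ShD(1)] by (auto simp: Sh_def R.a_assoc)
qed (rule Sh_add_closed)

lemma ext_add:
  assumes t: "t \<in> carrier (Sh K L)" and u: "u \<in> carrier (Sh K L)"
  shows "ext (t \<oplus>\<^bsub>Sh K L\<^esub> u) = ext t \<oplus>\<^bsub>A\<^esub> ext u"
proof -
  define F where "F = supp t \<union> supp u"
  have F: "finite F" "F \<subseteq> carrier L" "supp t \<subseteq> F" "supp u \<subseteq> F"
    using t u ShD(2) by (auto simp: F_def fun_support_def)
  have sF: "supp (t \<oplus>\<^bsub>Sh K L\<^esub> u) \<subseteq> F"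
    by (auto simp: F_def fun_support_def Sh_def)
  have "ext (t \<oplus>\<^bsub>Sh K L\<^esub> u) = (\<Oplus>\<^bsub>A\<^esub>y\<in>F. (t \<oplus>\<^bsub>Sh K L\<^esub> u) y \<odot>\<^bsub>A\<^esub> m y)"
    by (rule ext_eq_finsum[OF Sh_add_closed[OF t u] F(1) sF F(2)])
  also have "\<dots> = (\<Oplus>\<^bsub>A\<^esub>y\<in>F. t y \<odot>\<^bsub>A\<^esub> m y \<oplus>\<^bsub>A\<^esub> u y \<odot>\<^bsub>A\<^esub> m y)"
    by (rule M.finsum_cong')
      (use F(2) ShD(1)[OF t] ShD(1)[OF u] in \<open>auto simp: Sh_def smult_l_distr subset_iff\<close>)
  also have "\<dots> = (\<Oplus>\<^bsub>A\<^esub>y\<in>F. t y \<odot>\<^bsub>A\<^esub> m y) \<oplus>\<^bsub>A\<^esub> (\<Oplus>\<^bsub>A\<^esub>y\<in>F. u y \<odot>\<^bsub>A\<^esub> m y)"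
    by (rule M.finsum_addf) (use F(2) ShD(1)[OF t] ShD(1)[OF u] in auto)
  also have "\<dots> = ext t \<oplus>\<^bsub>A\<^esub> ext u"
    using ext_eq_finsum[OF t] ext_eq_finsum[OF u] F by simp
  finally show ?thesis .
qed

lemma ext_smult:
  assumes c: "c \<in> carrier K" and t: "t \<in> carrier (Sh K L)"
  shows "ext (c \<odot>\<^bsub>Sh K L\<^esub> t) = c \<odot>\<^bsub>A\<^esub> ext t"
proof -
  have F: "finite (supp t)" "supp t \<subseteq> carrier L" "supp (c \<odot>\<^bsub>Sh K L\<^esub> t) \<subseteq> supp t"
    using ShD(2)[OF t] c by (auto simp: fun_support_def Sh_def)
  have "ext (c \<odot>\<^bsub>Sh K L\<^esub> t) = (\<Oplus>\<^bsub>A\<^esub>y\<in>supp t. (c \<odot>\<^bsub>Sh K L\<^esub> t) y \<odot>\<^bsub>A\<^esub> m y)"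
    by (rule ext_eq_finsum[OF Sh_smult_closed[OF c t] F(1,3,2)])
  also have "\<dots> = (\<Oplus>\<^bsub>A\<^esub>y\<in>supp t. c \<odot>\<^bsub>A\<^esub> (t y \<odot>\<^bsub>A\<^esub> m y))"
    by (rule M.finsum_cong')
      (use F(2) c ShD(1)[OF t] in \<open>auto simp: Sh_def smult_assoc1 subset_iff\<close>)
  also have "\<dots> = c \<odot>\<^bsub>A\<^esub> ext t"
    unfolding ext_def
    by (rule finsum_smult_ldistr[symmetric]) (use F c ShD(1)[OF t] in auto)
  finally show ?thesis .
qed

subsection \<open>Delta functions and convolution\<close>

text \<open>The group element \<open>y\<close> as an element of the group algebra.\<close>

definition delta :: "'g \<Rightarrow> 'g \<Rightarrow> 'k" where
  "delta y = (\<lambda>x\<in>carrier L. if x = y then \<one>\<^bsub>K\<^esub> else \<zero>\<^bsub>K\<^esub>)"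

lemma delta_closed: "y \<in> carrier L \<Longrightarrow> delta y \<in> carrier (Sh K L)"
  by (rule ShI[where F = "{y}"]) (auto simp: delta_def)

lemma ext_delta:
  assumes y: "y \<in> carrier L"
  shows "ext (delta y) = m y"
proof -
  have "ext (delta y) = (\<Oplus>\<^bsub>A\<^esub>z\<in>{y}. delta y z \<odot>\<^bsub>A\<^esub> m z)"
    by (rule ext_eq_finsum[OF delta_closed[OF y]]) (use y in \<open>auto simp: fun_support_def delta_def\<close>)
  also have "\<dots> = m y"
    using y by (simp add: M.finsum_insert delta_def)
  finally show ?thesis .
qed

lemma Sh_one: "\<one>\<^bsub>Sh K L\<^esub> = delta \<one>\<^bsub>L\<^esub>"
  by (simp add: Sh_def delta_def)

text \<open>The support of a convolution lies in the product of the supports.\<close>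

lemma Sh_mult_eq_zero:
  assumes t: "t \<in> carrier (Sh K L)" and u: "u \<in> carrier (Sh K L)" and x: "x \<in> carrier L"
    and "x \<notin> (\<lambda>(y, z). y \<otimes>\<^bsub>L\<^esub> z) ` (supp t \<times> supp u)"
  shows "(t \<otimes>\<^bsub>Sh K L\<^esub> u) x = \<zero>\<^bsub>K\<^esub>"
proof -
  have "t y \<otimes>\<^bsub>K\<^esub> u (inv\<^bsub>L\<^esub> y \<otimes>\<^bsub>L\<^esub> x) = \<zero>\<^bsub>K\<^esub>" if y: "y \<in> supp t" for y
  proof -
    have yL: "y \<in> carrier L" using y supp_subset by auto
    have "x = y \<otimes>\<^bsub>L\<^esub> (inv\<^bsub>L\<^esub> y \<otimes>\<^bsub>L\<^esub> x)"
      using x yL by (simp add: L.m_assoc[symmetric])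
    then have "inv\<^bsub>L\<^esub> y \<otimes>\<^bsub>L\<^esub> x \<notin> supp u"
      using assms(4) y by (auto simp: image_iff)
    then have "u (inv\<^bsub>L\<^esub> y \<otimes>\<^bsub>L\<^esub> x) = \<zero>\<^bsub>K\<^esub>"
      using x yL by (auto simp: fun_support_def)
    then show ?thesis using ShD(1)[OF t yL] by simp
  qed
  then have "(\<Oplus>\<^bsub>K\<^esub>y\<in>supp t. t y \<otimes>\<^bsub>K\<^esub> u (inv\<^bsub>L\<^esub> y \<otimes>\<^bsub>L\<^esub> x)) = \<zero>\<^bsub>K\<^esub>"
    by (rule R.add.finprod_one_eqI)
  then show ?thesis using x by (simp add: Sh_def)
qed

lemma Sh_mult_closed:
  assumes t: "t \<in> carrier (Sh K L)" and u: "u \<in> carrier (Sh K L)"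
  shows "t \<otimes>\<^bsub>Sh K L\<^esub> u \<in> carrier (Sh K L)"
proof (rule ShI[where F = "(\<lambda>(y, z). y \<otimes>\<^bsub>L\<^esub> z) ` (supp t \<times> supp u)"])
  show "t \<otimes>\<^bsub>Sh K L\<^esub> u \<in> extensional (carrier L)"
    by (simp add: Sh_def)
  show "(t \<otimes>\<^bsub>Sh K L\<^esub> u) x \<in> carrier K" if x: "x \<in> carrier L" for x
    using x ShD(1)[OF t] ShD(1)[OF u] supp_subset[of t]
    by (auto simp: Sh_def subset_iff intro!: R.finsum_closed)
qed (use ShD(2)[OF t] ShD(2)[OF u] Sh_mult_eq_zero[OF t u] in auto)

lemma ext_mult:
  assumes t: "t \<in> carrier (Sh K L)" and u: "u \<in> carrier (Sh K L)"
  shows "ext (t \<otimes>\<^bsub>Sh K L\<^esub> u) = ext t \<otimes>\<^bsub>A\<^esub> ext u"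
proof -
  define T where "T = supp t"
  define U where "U = supp u"
  define P where "P = (\<lambda>(y, z). y \<otimes>\<^bsub>L\<^esub> z) ` (T \<times> U)"
  have fin: "finite T" "finite U" "finite P"
    using ShD(2)[OF t] ShD(2)[OF u] by (auto simp: T_def U_def P_def)
  have sub: "T \<subseteq> carrier L" "U \<subseteq> carrier L"
    using supp_subset by (auto simp: T_def U_def)
  then have subP: "P \<subseteq> carrier L" by (auto simp: P_def)
  have tT: "t y \<in> carrier K" if "y \<in> T" for y using that sub ShD(1)[OF t] by auto
  have mL: "m y \<in> carrier A" if "y \<in> T \<union> U \<union> P" for y using that sub subP by auto
  have u_shift: "u (inv\<^bsub>L\<^esub> y \<otimes>\<^bsub>L\<^esub> x) \<in> carrier K" if "y \<in> T" "x \<in> P" for x y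
    using that sub subP by (intro ShD(1)[OF u]) auto
  have inner: "(\<Oplus>\<^bsub>A\<^esub>x\<in>P. (t y \<otimes>\<^bsub>K\<^esub> u (inv\<^bsub>L\<^esub> y \<otimes>\<^bsub>L\<^esub> x)) \<odot>\<^bsub>A\<^esub> m x) = (t y \<odot>\<^bsub>A\<^esub> m y) \<otimes>\<^bsub>A\<^esub> ext u"
    if y: "y \<in> T" for y
  proof -
    let ?g = "\<lambda>x. (t y \<otimes>\<^bsub>K\<^esub> u (inv\<^bsub>L\<^esub> y \<otimes>\<^bsub>L\<^esub> x)) \<odot>\<^bsub>A\<^esub> m x"
    let ?s = "\<lambda>z. y \<otimes>\<^bsub>L\<^esub> z"
    have yL: "y \<in> carrier L" using y sub by auto
    have shift: "?s ` U \<subseteq> P" using y by (auto simp: P_def)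
    have g: "?g \<in> P \<rightarrow> carrier A" using y tT u_shift mL by auto
    have "(\<Oplus>\<^bsub>A\<^esub>x\<in>P. ?g x) = (\<Oplus>\<^bsub>A\<^esub>x\<in>?s ` U. ?g x)"
    proof (rule M.add.finprod_mono_neutral_cong_left[symmetric, OF fin(3) shift])
      fix x assume x: "x \<in> P - ?s ` U"
      then have xL: "x \<in> carrier L" using subP by auto
      have "x = y \<otimes>\<^bsub>L\<^esub> (inv\<^bsub>L\<^esub> y \<otimes>\<^bsub>L\<^esub> x)"
        using xL yL by (simp add: L.m_assoc[symmetric])
      then have "inv\<^bsub>L\<^esub> y \<otimes>\<^bsub>L\<^esub> x \<notin> U" using x by blast
      then have "u (inv\<^bsub>L\<^esub> y \<otimes>\<^bsub>L\<^esub> x) = \<zero>\<^bsub>K\<^esub>"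
        using xL yL by (auto simp: U_def fun_support_def)
      then show "?g x = \<zero>\<^bsub>A\<^esub>"
        using tT[OF y] xL by simp
    qed (use g in auto)
    \<comment> \<open>The substitution \<open>x = y \<otimes> z\<close> turns the convolution sum for fixed \<open>y\<close> into a sum over the support of \<open>u\<close>.\<close>
    also have "\<dots> = (\<Oplus>\<^bsub>A\<^esub>z\<in>U. ?g (?s z))"
      by (rule M.add.finprod_reindex) (use g shift yL sub in \<open>auto simp: inj_on_def subset_iff\<close>)
    also have "\<dots> = (\<Oplus>\<^bsub>A\<^esub>z\<in>U. (t y \<odot>\<^bsub>A\<^esub> m y) \<otimes>\<^bsub>A\<^esub> (u z \<odot>\<^bsub>A\<^esub> m z))"
    proof (rule M.finsum_cong'[OF refl])
      fix z assume z: "z \<in> U"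
      then have zL: "z \<in> carrier L" using sub by auto
      have uz: "u z \<in> carrier K" using ShD(1)[OF u zL] .
      have "?g (?s z) = (t y \<otimes>\<^bsub>K\<^esub> u z) \<odot>\<^bsub>A\<^esub> (m y \<otimes>\<^bsub>A\<^esub> m z)"
        using yL zL by (simp add: L.m_assoc[symmetric] m_mult)
      also have "\<dots> = t y \<odot>\<^bsub>A\<^esub> (u z \<odot>\<^bsub>A\<^esub> (m z \<otimes>\<^bsub>A\<^esub> m y))"
        using yL zL uz tT[OF y] by (simp add: smult_assoc1 m_comm)
      also have "\<dots> = (t y \<odot>\<^bsub>A\<^esub> m y) \<otimes>\<^bsub>A\<^esub> (u z \<odot>\<^bsub>A\<^esub> m z)"
        using yL zL uz tT[OF y] smult_assoc2[of "t y" "m y" "u z \<odot>\<^bsub>A\<^esub> m z"]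
          smult_assoc2[of "u z" "m z" "m y"] m_comm[of "m y" "u z \<odot>\<^bsub>A\<^esub> m z"] by simp
      finally show "?g (?s z) = (t y \<odot>\<^bsub>A\<^esub> m y) \<otimes>\<^bsub>A\<^esub> (u z \<odot>\<^bsub>A\<^esub> m z)" .
    qed (use yL sub tT[OF y] ShD(1)[OF u] in auto)
    also have "\<dots> = (t y \<odot>\<^bsub>A\<^esub> m y) \<otimes>\<^bsub>A\<^esub> ext u"
      unfolding ext_def U_def[symmetric]
      by (rule finsum_rdistr[symmetric]) (use fin yL sub tT[OF y] ShD(1)[OF u] in auto)
    finally show ?thesis .
  qed
  have "supp (t \<otimes>\<^bsub>Sh K L\<^esub> u) \<subseteq> P"
    using Sh_mult_eq_zero[OF t u] by (auto simp: P_def T_def U_def fun_support_def)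
  then have "ext (t \<otimes>\<^bsub>Sh K L\<^esub> u) = (\<Oplus>\<^bsub>A\<^esub>x\<in>P. (t \<otimes>\<^bsub>Sh K L\<^esub> u) x \<odot>\<^bsub>A\<^esub> m x)"
    using ext_eq_finsum[OF Sh_mult_closed[OF t u] fin(3)] subP by blast
  also have "\<dots> = (\<Oplus>\<^bsub>A\<^esub>x\<in>P. \<Oplus>\<^bsub>A\<^esub>y\<in>T. (t y \<otimes>\<^bsub>K\<^esub> u (inv\<^bsub>L\<^esub> y \<otimes>\<^bsub>L\<^esub> x)) \<odot>\<^bsub>A\<^esub> m x)"
  proof (rule M.finsum_cong'[OF refl])
    fix x assume x: "x \<in> P"
    have "(t \<otimes>\<^bsub>Sh K L\<^esub> u) x = (\<Oplus>\<^bsub>K\<^esub>y\<in>T. t y \<otimes>\<^bsub>K\<^esub> u (inv\<^bsub>L\<^esub> y \<otimes>\<^bsub>L\<^esub> x))"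
      using x subP by (auto simp: Sh_def T_def)
    then show "(t \<otimes>\<^bsub>Sh K L\<^esub> u) x \<odot>\<^bsub>A\<^esub> m x
        = (\<Oplus>\<^bsub>A\<^esub>y\<in>T. (t y \<otimes>\<^bsub>K\<^esub> u (inv\<^bsub>L\<^esub> y \<otimes>\<^bsub>L\<^esub> x)) \<odot>\<^bsub>A\<^esub> m x)"
      using finsum_smult_rdistr[OF fin(1) _ mL] x tT u_shift by simp
  qed (use tT u_shift mL in \<open>auto intro!: M.finsum_closed\<close>)
  also have "\<dots> = (\<Oplus>\<^bsub>A\<^esub>y\<in>T. \<Oplus>\<^bsub>A\<^esub>x\<in>P. (t y \<otimes>\<^bsub>K\<^esub> u (inv\<^bsub>L\<^esub> y \<otimes>\<^bsub>L\<^esub> x)) \<odot>\<^bsub>A\<^esub> m x)"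
    by (rule M.finsum_swap) (use fin tT u_shift mL in auto)
  also have "\<dots> = (\<Oplus>\<^bsub>A\<^esub>y\<in>T. (t y \<odot>\<^bsub>A\<^esub> m y) \<otimes>\<^bsub>A\<^esub> ext u)"
    by (rule M.finsum_cong') (use inner tT mL ext_closed[OF u] in auto)
  also have "\<dots> = ext t \<otimes>\<^bsub>A\<^esub> ext u"
    unfolding ext_def[of t] T_def[symmetric]
    by (rule finsum_ldistr[symmetric]) (use fin tT mL ext_closed[OF u] in auto)
  finally show ?thesis .
qed

lemma m_in_image: "x \<in> carrier L \<Longrightarrow> m x \<in> ext ` carrier (Sh K L)"
  using delta_closed ext_delta by force

lemma image_ext_uminus:
  assumes "x \<in> ext ` carrier (Sh K L)"
  shows "\<ominus>\<^bsub>A\<^esub> x \<in> ext ` carrier (Sh K L)"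
proof -
  obtain t where t: "t \<in> carrier (Sh K L)" "x = ext t" using assms by auto
  \<comment> \<open>Negation is scalar multiplication by \<open>-1\<close>.\<close>
  have "\<ominus>\<^bsub>A\<^esub> x = ext ((\<ominus>\<^bsub>K\<^esub> \<one>\<^bsub>K\<^esub>) \<odot>\<^bsub>Sh K L\<^esub> t)"
    using t by (simp add: ext_smult smult_l_minus)
  then show ?thesis using Sh_smult_closed[of "\<ominus>\<^bsub>K\<^esub> \<one>\<^bsub>K\<^esub>" t] t(1) by simp
qed

lemma image_ext_add:
  assumes "x \<in> ext ` carrier (Sh K L)" "y \<in> ext ` carrier (Sh K L)"
  shows "x \<oplus>\<^bsub>A\<^esub> y \<in> ext ` carrier (Sh K L)"
  using assms by (auto simp: ext_add[symmetric] intro!: imageI Sh_add_closed)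

lemma subring_image_ext: "subring (ext ` carrier (Sh K L)) A"
proof (rule subringI)
  show "\<one>\<^bsub>A\<^esub> \<in> ext ` carrier (Sh K L)"
    using m_in_image[OF L.one_closed] by (simp add: m_one)
  show "x \<otimes>\<^bsub>A\<^esub> y \<in> ext ` carrier (Sh K L)"
    if "x \<in> ext ` carrier (Sh K L)" "y \<in> ext ` carrier (Sh K L)" for x y
    using that by (auto simp: ext_mult[symmetric] intro!: imageI Sh_mult_closed)
qed (auto intro: image_ext_add image_ext_uminus)

lemma submodule_image_ext: "submodule (ext ` carrier (Sh K L)) K A"
proof (rule submoduleI)
  show "\<zero>\<^bsub>A\<^esub> \<in> ext ` carrier (Sh K L)"
    using subring_image_ext subringE(2) by blast
  show "c \<odot>\<^bsub>A\<^esub> x \<in> ext ` carrier (Sh K L)"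
    if "c \<in> carrier K" "x \<in> ext ` carrier (Sh K L)" for c x
    using that by (auto simp: ext_smult[symmetric] intro!: imageI Sh_smult_closed)
qed (auto intro: image_ext_add image_ext_uminus)

lemma image_ext_eq_carrier:
  assumes "generated_algebra K A S = carrier A" and "S \<subseteq> m ` carrier L"
  shows "ext ` carrier (Sh K L) = carrier A"
proof
  have "S \<subseteq> ext ` carrier (Sh K L)"
    using assms(2) m_in_image by blast
  then have "generated_algebra K A S \<subseteq> ext ` carrier (Sh K L)"
    unfolding generated_algebra_def using subring_image_ext submodule_image_ext by blast
  then show "carrier A \<subseteq> ext ` carrier (Sh K L)" using assms(1) by simp
qed auto


section \<open>The annihilator of a character composed with a Frobenius form\<close>

text \<open>
  Translating \<open>f = ell \<circ> m\<close> by \<open>y\<close> amounts to multiplying by \<open>m y\<close> under \<open>ell\<close>, so the action of \<open>t\<close> amounts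
  to multiplying by \<open>ext t\<close>.
\<close>

lemma Sh_action_eq:
  assumes ell: "linear_form K A ell" and t: "t \<in> carrier (Sh K L)" and x: "x \<in> carrier L"
  shows "Sh_action K L t (\<lambda>y. ell (m y)) x = ell (ext t \<otimes>\<^bsub>A\<^esub> m x)"
proof -
  have tc: "t y \<in> carrier K" "y \<in> carrier L" if "y \<in> supp t" for y
    using that ShD(1)[OF t] by (auto simp: fun_support_def)
  have fin: "finite (supp t)" by (rule ShD(2)[OF t])
  have lin: "z \<in> carrier A \<Longrightarrow> ell z \<in> carrier K"
    "c \<in> carrier K \<Longrightarrow> z \<in> carrier A \<Longrightarrow> ell (c \<odot>\<^bsub>A\<^esub> z) = c \<otimes>\<^bsub>K\<^esub> ell z" for c z
    using ell by (auto simp: linear_form_def)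
  have "ext t \<otimes>\<^bsub>A\<^esub> m x = (\<Oplus>\<^bsub>A\<^esub>y\<in>supp t. (t y \<odot>\<^bsub>A\<^esub> m y) \<otimes>\<^bsub>A\<^esub> m x)"
    unfolding ext_def by (rule finsum_ldistr) (use fin tc x in auto)
  then have "ell (ext t \<otimes>\<^bsub>A\<^esub> m x) = (\<Oplus>\<^bsub>K\<^esub>y\<in>supp t. ell ((t y \<odot>\<^bsub>A\<^esub> m y) \<otimes>\<^bsub>A\<^esub> m x))"
    using linear_form_finsum[OF ell fin] tc x by simp
  also have "\<dots> = (\<Oplus>\<^bsub>K\<^esub>y\<in>supp t. t y \<otimes>\<^bsub>K\<^esub> ell (m (x \<otimes>\<^bsub>L\<^esub> y)))"
  proof (rule R.finsum_cong'[OF refl])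
    fix y assume y: "y \<in> supp t"
    have "m y \<otimes>\<^bsub>A\<^esub> m x = m (x \<otimes>\<^bsub>L\<^esub> y)"
      using tc(2)[OF y] x by (simp add: m_mult m_comm)
    then show "ell ((t y \<odot>\<^bsub>A\<^esub> m y) \<otimes>\<^bsub>A\<^esub> m x) = t y \<otimes>\<^bsub>K\<^esub> ell (m (x \<otimes>\<^bsub>L\<^esub> y))"
      using tc[OF y] x by (simp add: smult_assoc2 lin)
  qed (use tc x in \<open>auto simp: lin\<close>)
  finally show ?thesis by (simp add: Sh_action_def)
qed

lemma Ann_eq_kernel:
  assumes frob: "frobenius_duality K A ell" and surj: "ext ` carrier (Sh K L) = carrier A"
  shows "Ann K L (\<lambda>y. ell (m y)) = {t \<in> carrier (Sh K L). ext t = \<zero>\<^bsub>A\<^esub>}"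
proof -
  have ell: "linear_form K A ell" using frob by (simp add: frobenius_duality_def)
  then have lin: "z \<in> carrier A \<Longrightarrow> ell z \<in> carrier K"
    "c \<in> carrier K \<Longrightarrow> z \<in> carrier A \<Longrightarrow> ell (c \<odot>\<^bsub>A\<^esub> z) = c \<otimes>\<^bsub>K\<^esub> ell z" for c z
    by (auto simp: linear_form_def)
  have ell_zero: "ell \<zero>\<^bsub>A\<^esub> = \<zero>\<^bsub>K\<^esub>"
    using linear_form_finsum[OF ell, of "{}"] by simp
  have kernel: "(\<forall>x\<in>carrier L. ell (ext t \<otimes>\<^bsub>A\<^esub> m x) = \<zero>\<^bsub>K\<^esub>) \<longleftrightarrow> ext t = \<zero>\<^bsub>A\<^esub>"
    if t: "t \<in> carrier (Sh K L)" for t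
  proof
    assume 0: "\<forall>x\<in>carrier L. ell (ext t \<otimes>\<^bsub>A\<^esub> m x) = \<zero>\<^bsub>K\<^esub>"
    have "ell (ext t \<otimes>\<^bsub>A\<^esub> z) = \<zero>\<^bsub>K\<^esub>" if "z \<in> carrier A" for z
    proof -
      \<comment> \<open>Write \<open>z\<close> as a combination of values of \<open>m\<close>, to each of which \<open>ext t\<close> is orthogonal.\<close>
      obtain u where u: "u \<in> carrier (Sh K L)" "z = ext u" using \<open>z \<in> carrier A\<close> surj by blast
      have uc: "u y \<in> carrier K" "y \<in> carrier L" if "y \<in> supp u" for y
        using that ShD(1)[OF u(1)] by (auto simp: fun_support_def)
      have fin: "finite (supp u)" by (rule ShD(2)[OF u(1)])
      have "ext t \<otimes>\<^bsub>A\<^esub> z = (\<Oplus>\<^bsub>A\<^esub>y\<in>supp u. ext t \<otimes>\<^bsub>A\<^esub> (u y \<odot>\<^bsub>A\<^esub> m y))"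
        unfolding u(2) ext_def[of u] by (rule finsum_rdistr) (use fin uc t in auto)
      then have "ell (ext t \<otimes>\<^bsub>A\<^esub> z) = (\<Oplus>\<^bsub>K\<^esub>y\<in>supp u. ell (ext t \<otimes>\<^bsub>A\<^esub> (u y \<odot>\<^bsub>A\<^esub> m y)))"
        using linear_form_finsum[OF ell fin] uc t by simp
      also have "\<dots> = \<zero>\<^bsub>K\<^esub>"
      proof (rule R.add.finprod_one_eqI)
        fix y assume y: "y \<in> supp u"
        have "ext t \<otimes>\<^bsub>A\<^esub> (u y \<odot>\<^bsub>A\<^esub> m y) = u y \<odot>\<^bsub>A\<^esub> (ext t \<otimes>\<^bsub>A\<^esub> m y)"
          using uc[OF y] t by (simp add: m_comm[of "ext t"] smult_assoc2)
        then show "ell (ext t \<otimes>\<^bsub>A\<^esub> (u y \<odot>\<^bsub>A\<^esub> m y)) = \<zero>\<^bsub>K\<^esub>"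
          using uc[OF y] t 0 by (simp add: lin)
      qed
      finally show ?thesis .
    qed
    then show "ext t = \<zero>\<^bsub>A\<^esub>"
      using frob t by (auto simp: frobenius_duality_def)
  next
    assume "ext t = \<zero>\<^bsub>A\<^esub>"
    then show "\<forall>x\<in>carrier L. ell (ext t \<otimes>\<^bsub>A\<^esub> m x) = \<zero>\<^bsub>K\<^esub>"
      by (simp add: ell_zero)
  qed
  have "Ann K L (\<lambda>y. ell (m y))
      = {t \<in> carrier (Sh K L). \<forall>x\<in>carrier L. ell (ext t \<otimes>\<^bsub>A\<^esub> m x) = \<zero>\<^bsub>K\<^esub>}"
    by (auto simp: Ann_def Sh_action_eq[OF ell])
  then show ?thesis using kernel by auto
qed

lemma algebra_isomorphic_K_alg:
  assumes "frobenius_duality K A ell" and surj: "ext ` carrier (Sh K L) = carrier A"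
  shows "algebra_isomorphic K A (K_alg K L (\<lambda>y. ell (m y)))"
  unfolding K_alg_def Ann_eq_kernel[OF assms]
  by (rule quotient_algebra_kernel_iso)
    (use surj in \<open>simp_all add: Sh_abelian_group M.abelian_group_axioms Sh_mult_closed Sh_one
      delta_closed Sh_smult_closed ext_add ext_mult ext_delta m_one ext_smult\<close>)

end


section \<open>Monomials with integer exponents\<close>

text \<open>
  Laws for integer powers hold in groups; they are transferred to the units of a monoid through the
  group of units.
\<close>

lemma (in monoid) units_of_int_pow:
  assumes "x \<in> Units G"
  shows "x [^]\<^bsub>units_of G\<^esub> (n::int) = x [^] n"
proof -
  have "x [^]\<^bsub>units_of G\<^esub> (k::nat) = x [^] k" for k
    by (induction k) (simp_all add: units_of_mult units_of_one)
  moreover have "x [^] (k::nat) \<in> Units G" for k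
    using assms by (induction k) auto
  ultimately show ?thesis
    by (simp only: int_pow_def2 units_of_inv)
qed

lemma (in monoid) Units_int_pow_closed:
  "x \<in> Units G \<Longrightarrow> x [^] (n::int) \<in> carrier G"
  using group.int_pow_closed[OF units_group, of x n]
  by (simp add: units_of_carrier units_of_int_pow Units_closed)

lemma (in monoid) Units_int_pow_mult:
  "x \<in> Units G \<Longrightarrow> x [^] (i + j::int) = x [^] i \<otimes> x [^] j"
  using group.int_pow_mult[OF units_group, of x i j]
  by (simp add: units_of_carrier units_of_int_pow units_of_mult)

lemma (in monoid) Units_int_pow_1:
  "x \<in> Units G \<Longrightarrow> x [^] (1::int) = x"
  using group.int_pow_1[OF units_group, of x]
  by (simp add: units_of_carrier units_of_int_pow)

lemma group_character_monomial:
  assumes "algebra K A" and a: "\<And>i. i \<in> {1..s} \<Longrightarrow> a i \<in> Units A"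
  shows "group_character K A (int_lattice s) (\<lambda>n. \<Otimes>\<^bsub>A\<^esub>i\<in>{1..s}. a i [^]\<^bsub>A\<^esub> (n i :: int))"
proof -
  interpret algebra K A by fact
  interpret L: group "int_lattice s"
    by (simp add: int_lattice_def)
  show ?thesis
  proof
    fix x y assume "x \<in> carrier (int_lattice s)" "y \<in> carrier (int_lattice s)"
    have "(\<Otimes>\<^bsub>A\<^esub>i\<in>{1..s}. a i [^]\<^bsub>A\<^esub> ((x \<otimes>\<^bsub>int_lattice s\<^esub> y) i))
        = (\<Otimes>\<^bsub>A\<^esub>i\<in>{1..s}. a i [^]\<^bsub>A\<^esub> x i \<otimes>\<^bsub>A\<^esub> a i [^]\<^bsub>A\<^esub> y i)"
      by (rule finprod_cong')
        (use a in \<open>auto simp: int_lattice_def Units_int_pow_mult Units_int_pow_closed\<close>)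
    also have "\<dots> = (\<Otimes>\<^bsub>A\<^esub>i\<in>{1..s}. a i [^]\<^bsub>A\<^esub> x i) \<otimes>\<^bsub>A\<^esub> (\<Otimes>\<^bsub>A\<^esub>i\<in>{1..s}. a i [^]\<^bsub>A\<^esub> y i)"
      by (rule finprod_multf) (use a in \<open>auto simp: Units_int_pow_closed\<close>)
    finally show "(\<Otimes>\<^bsub>A\<^esub>i\<in>{1..s}. a i [^]\<^bsub>A\<^esub> ((x \<otimes>\<^bsub>int_lattice s\<^esub> y) i))
        = (\<Otimes>\<^bsub>A\<^esub>i\<in>{1..s}. a i [^]\<^bsub>A\<^esub> x i) \<otimes>\<^bsub>A\<^esub> (\<Otimes>\<^bsub>A\<^esub>i\<in>{1..s}. a i [^]\<^bsub>A\<^esub> y i)" .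
  next
    show "(\<Otimes>\<^bsub>A\<^esub>i\<in>{1..s}. a i [^]\<^bsub>A\<^esub> \<one>\<^bsub>int_lattice s\<^esub> i) = \<one>\<^bsub>A\<^esub>"
      by (rule finprod_one_eqI) (auto simp: int_lattice_def)
  qed (use a in \<open>auto intro!: finprod_closed simp: Units_int_pow_closed\<close>)
qed

lemma generator_eq_monomial:
  assumes "comm_monoid A" and a: "\<And>i. i \<in> {1..s} \<Longrightarrow> a i \<in> Units A" and j: "j \<in> {1..s}"
  shows "a j \<in> (\<lambda>n. \<Otimes>\<^bsub>A\<^esub>i\<in>{1..s}. a i [^]\<^bsub>A\<^esub> (n i :: int)) ` carrier (int_lattice s)"
proof -
  interpret comm_monoid A by fact
  \<comment> \<open>the \<open>j\<close>-th standard basis vector\<close>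
  define e :: "nat \<Rightarrow> int" where "e = (\<lambda>i\<in>{1..s}. if i = j then 1 else 0)"
  have "(\<Otimes>\<^bsub>A\<^esub>i\<in>{1..s}. a i [^]\<^bsub>A\<^esub> e i) = (\<Otimes>\<^bsub>A\<^esub>i\<in>{1..s}. if i = j then a i else \<one>\<^bsub>A\<^esub>)"
    by (rule finprod_cong') (use a in \<open>auto simp: e_def Units_int_pow_1 intro: Units_closed\<close>)
  also have "\<dots> = a j"
    by (rule finprod_singleton_swap) (use a j in \<open>auto intro: Units_closed\<close>)
  finally show ?thesis
    by (intro image_eqI[where x = e]) (auto simp: int_lattice_def e_def)
qed

theorem theorem2p4:
  fixes K :: "('k, 'm) ring_scheme"
    and A :: "('k, 'a, 'n) module_scheme"
    and s :: nat
    and a :: "nat \<Rightarrow> 'a"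
    and ell :: "'a \<Rightarrow> 'k"
  assumes "field K"
    and "algebra K A"
    and "\<And>i. i \<in> {1..s} \<Longrightarrow> a i \<in> Units A"
    and "generated_algebra K A (a ` {1..s}) = carrier A"
    and "frobenius_duality K A ell"
  shows "algebra_isomorphic K A
           (K_alg K (int_lattice s) (\<lambda>n. ell (\<Otimes>\<^bsub>A\<^esub>i\<in>{1..s}. a i [^]\<^bsub>A\<^esub> n i)))"
proof -
  interpret group_character K A "int_lattice s" "\<lambda>n. \<Otimes>\<^bsub>A\<^esub>i\<in>{1..s}. a i [^]\<^bsub>A\<^esub> (n i :: int)"
    using assms(2,3) by (rule group_character_monomial)
  have "a ` {1..s}
      \<subseteq> (\<lambda>n. \<Otimes>\<^bsub>A\<^esub>i\<in>{1..s}. a i [^]\<^bsub>A\<^esub> (n i :: int)) ` carrier (int_lattice s)"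
    by (intro image_subsetI generator_eq_monomial comm_monoid_axioms assms(3))
  then show ?thesis
    by (rule algebra_isomorphic_K_alg[OF assms(5) image_ext_eq_carrier[OF assms(4)]])
qed

end
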